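(* Let $N \geq 1$ be an integer and let $|\psi\rangle, |\phi\rangle \in (\mathbb{C}^2)^{\otimes N}$ be symmetric $N$-qubit states. If there exist invertible linear operators $A_1, \ldots, A_N : \mathbb{C}^2 \to \mathbb{C}^2$ such that $$|\phi\rangle = (A_1 \otimes \cdots \otimes A_N)\,|\psi\rangle,$$ then there exists an invertible linear operator $A : \mathbb{C}^2 \to \mathbb{C}^2$ such that $$|\phi\rangle = A^{\otimes N}\,|\psi\rangle.$$
   Context: An $N$-qubit state is a nonzero vector of $(\mathbb{C}^2)^{\otimes N}$ (not required to be normalized). The symmetric group on $\{1,\ldots,N\}$ acts linearly on $(\mathbb{C}^2)^{\otimes N}$ by permuting the tensor factors; a state is symmetric if it is fixed by every permutation. $A^{\otimes N}$ denotes $A \otimes \cdots \otimes A$ ($N$ factors). *)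

theory Defs
  imports "HOL-Analysis.Analysis"
begin

text \<open>
  The tensor factors are labelled by a finite type \<open>'n\<close>, so that \<open>N = CARD('n) \<ge> 1\<close>.
  A vector of the \<open>N\<close>-fold tensor power of \<open>complex ^ 2\<close> is given by its coordinates in the
  basis of the vectors \<open>e (i 1) \<otimes> \<dots> \<otimes> e (i N)\<close>, one for each \<open>i :: 'n \<Rightarrow> 2\<close>; linear operators on
  \<open>complex ^ 2\<close> are given by their matrices.
\<close>

type_synonym 'n qubits = "(complex, 'n \<Rightarrow> 2) vec"

definition tensor_vec :: "('n::finite \<Rightarrow> complex ^ 2) \<Rightarrow> 'n qubits" where
  "tensor_vec v = (\<chi> i. \<Prod>k\<in>UNIV. v k $ i k)"

definition tensor_op ::
    "('n::finite \<Rightarrow> complex ^ 2 ^ 2) \<Rightarrow> complex ^ ('n \<Rightarrow> 2) ^ ('n \<Rightarrow> 2)" where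
  "tensor_op A = (\<chi> i j. \<Prod>k\<in>UNIV. A k $ i k $ j k)"

abbreviation tensor_power_op ::
    "complex ^ 2 ^ 2 \<Rightarrow> complex ^ ('n::finite \<Rightarrow> 2) ^ ('n \<Rightarrow> 2)" where
  "tensor_power_op A \<equiv> tensor_op (\<lambda>_. A)"

definition permute_factors :: "('n::finite \<Rightarrow> 'n) \<Rightarrow> 'n qubits \<Rightarrow> 'n qubits" where
  "permute_factors \<sigma> \<psi> = (\<chi> i. \<psi> $ (i \<circ> \<sigma>))"

definition symmetric_state :: "'n::finite qubits \<Rightarrow> bool" where
  "symmetric_state \<psi> \<longleftrightarrow>
     \<psi> \<noteq> 0 \<and> (\<forall>\<sigma>. \<sigma> permutes UNIV \<longrightarrow> permute_factors \<sigma> \<psi> = \<psi>)"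

text \<open>
  The coordinate formulas agree with the usual characterisations on product vectors, which
  include the standard basis.
\<close>

lemma tensor_vec_axis: "tensor_vec (\<lambda>k. axis (i k) 1) = axis i 1"
proof -
  have "(\<Prod>k\<in>UNIV. axis (i k) 1 $ j k) = (axis i 1 $ j :: complex)" for j :: "'a \<Rightarrow> 2"
  proof (cases "j = i")
    case True
    then show ?thesis by simp
  next
    case False
    then obtain k where "j k \<noteq> i k" by auto
    then have "(\<Prod>k\<in>UNIV. axis (i k) 1 $ j k) = (0::complex)"
      by (intro prod_zero) (auto simp: axis_def)
    then show ?thesis using False by (simp add: axis_def)
  qed
  then show ?thesis by (simp add: tensor_vec_def vec_eq_iff)
qed

lemma tensor_op_tensor_vec:
  "tensor_op A *v tensor_vec v = tensor_vec (\<lambda>k. A k *v v k)"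
proof -
  have "(\<Sum>j\<in>UNIV. (\<Prod>k\<in>UNIV. A k $ i k $ j k) * (\<Prod>k\<in>UNIV. v k $ j k))
      = (\<Prod>k\<in>UNIV. \<Sum>l\<in>UNIV. A k $ i k $ l * v k $ l)" for i
    using prod_sum_PiE[of UNIV "\<lambda>_. UNIV" "\<lambda>k l. A k $ i k $ l * v k $ l"]
    by (simp add: PiE_UNIV_domain prod.distrib)
  then show ?thesis
    by (simp add: tensor_op_def tensor_vec_def matrix_vector_mult_def vec_eq_iff)
qed

lemma permute_factors_tensor_vec:
  assumes "\<sigma> permutes UNIV"
  shows "permute_factors \<sigma> (tensor_vec v) = tensor_vec (\<lambda>k. v (inv \<sigma> k))"
proof -
  have "(\<Prod>k\<in>UNIV. v k $ i (\<sigma> k)) = (\<Prod>k\<in>UNIV. v (inv \<sigma> k) $ i k)" for i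
    using prod.permute[OF assms, of "\<lambda>k. v (inv \<sigma> k) $ i k"] permutes_inverses(2)[OF assms]
    by (simp add: o_def)
  then show ?thesis
    by (simp add: permute_factors_def tensor_vec_def vec_eq_iff)
qed

end

theory Submission imports Defs begin

text \<open>
  Write \<open>M\<^bsub>k\<^esub>\<close> for \<open>M\<close> acting on factor \<open>k\<close>. Fix a factor \<open>p\<close> and put \<open>C k = (A p)\<inverse> (A k)\<close>.
  Exchanging factors \<open>p\<close> and \<open>k\<close> in \<open>\<phi> = (\<Otimes>A) \<psi>\<close> shows that \<open>C k\<close> slides along \<open>\<psi>\<close>: the vector
  \<open>(C k)\<^bsub>q\<^esub> \<psi>\<close> does not depend on \<open>q\<close>. Sliding all the \<open>C k\<close> to factor \<open>p\<close> gives
  \<open>(\<Otimes>C) \<psi> = D\<^bsub>p\<^esub> \<psi>\<close> with \<open>D\<close> the product of the \<open>C k\<close>. This vector is symmetric, so \<open>D\<close> slides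
  too, and so does every polynomial in \<open>D\<close>. As \<open>D\<close> is invertible it has an \<open>N\<close>-th root \<open>E\<close> of
  the form \<open>a + b D\<close>, and sliding now gives \<open>(\<Otimes>E) \<psi> = (E ^ N)\<^bsub>p\<^esub> \<psi> = D\<^bsub>p\<^esub> \<psi>\<close>. Hence
  \<open>(A p) E\<close> is the required operator.
\<close>

section \<open>Roots of invertible complex \<open>2 \<times> 2\<close> matrices\<close>

text \<open>Indexed by a list because the factors need not commute, so the order of multiplication
  has to be fixed.\<close>

definition matrix_prod :: "('a::semiring_1 ^ 'n ^ 'n) list \<Rightarrow> 'a ^ 'n ^ 'n" where
  "matrix_prod Ms = foldr (**) Ms (mat 1)"

lemma matrix_prod_simps [simp]:
  "matrix_prod [] = mat 1"
  "matrix_prod (M # Ms) = M ** matrix_prod Ms"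
  by (simp_all add: matrix_prod_def)

lemma invertible_matrix_prod:
  fixes Ms :: "('a::semiring_1 ^ 'n ^ 'n) list"
  assumes "\<And>M. M \<in> set Ms \<Longrightarrow> invertible M"
  shows "invertible (matrix_prod Ms)"
  using assms
proof (induction Ms)
  case Nil
  then show ?case by (auto simp: invertible_def)
next
  case (Cons M Ms)
  then show ?case by (simp add: invertible_mult)
qed

definition lin_comb :: "complex \<Rightarrow> complex \<Rightarrow> complex ^ 'n ^ 'n \<Rightarrow> complex ^ 'n ^ 'n" where
  "lin_comb a b D = (\<chi> i j. (if i = j then a else 0) + b * D $ i $ j)"

lemma lin_comb_trivial [simp]: "lin_comb 1 0 D = mat 1" "lin_comb 0 1 D = D"
  by (simp_all add: lin_comb_def mat_def vec_eq_iff)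

text \<open>Cayley-Hamilton: \<open>D ** D\<close> equals \<open>trace D\<close> times
  \<open>D\<close> minus \<open>det D\<close> times \<open>mat 1\<close>. Powers of a combination
  therefore stay in the span of \<open>mat 1\<close> and \<open>D\<close>, and only two coefficients
  need tracking.\<close>

lemma lin_comb_mult:
  fixes D :: "complex ^ 2 ^ 2"
  shows "lin_comb a b D ** lin_comb c d D
    = lin_comb (a * c - b * d * det D) (a * d + b * c + b * d * trace D) D"
  by (simp add: lin_comb_def matrix_matrix_mult_def vec_eq_iff forall_2 sum_2 det_2 trace_def
      algebra_simps)

text \<open>These are the roots of \<open>x * x - t * x + d\<close>; for the trace and determinant
  of a matrix they are its eigenvalues.\<close>

lemma sum_product_solution:
  fixes t d :: complex
  obtains l m where "t = l + m" "d = l * m"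
proof
  define s where "s = csqrt (t\<^sup>2 - 4 * d)"
  have s: "s * s = t * t - 4 * d"
    unfolding s_def by (metis power2_csqrt power2_eq_square)
  show "t = (t + s) / 2 + (t - s) / 2" by (simp add: field_simps)
  show "d = (t + s) / 2 * ((t - s) / 2)" using s by (simp add: field_simps)
qed

lemma matrix_root_exists:
  fixes D :: "complex ^ 2 ^ 2"
  assumes "invertible D" and "n > 0"
  obtains a b where "matrix_prod (replicate n (lin_comb a b D)) = D"
proof -
  obtain l m where lm: "trace D = l + m" "det D = l * m"
    by (rule sum_product_solution)
  obtain r s where r: "r ^ n = l" and s: "s ^ n = m"
    using exists_complex_root[of n] \<open>n > 0\<close> by (metis less_irrefl)
  show thesis
  proof (cases "l = m")
    case False
    \<comment> \<open>Lagrange interpolation of \<open>l \<mapsto> r ^ k\<close>, \<open>m \<mapsto> s ^ k\<close> at the eigenvalues\<close>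
    define E where "E k =
      lin_comb ((l * s ^ k - m * r ^ k) / (l - m)) ((r ^ k - s ^ k) / (l - m)) D" for k
    have step: "E 1 ** E k = E (Suc k)" for k
    proof -
      have "(l * s - m * r) / (l - m) * ((l * s ^ k - m * r ^ k) / (l - m))
          - (r - s) / (l - m) * ((r ^ k - s ^ k) / (l - m)) * (l * m)
          = (l * s ^ Suc k - m * r ^ Suc k) / (l - m)"
        using False by (simp add: divide_simps) (simp add: algebra_simps)
      moreover have "(l * s - m * r) / (l - m) * ((r ^ k - s ^ k) / (l - m))
          + (r - s) / (l - m) * ((l * s ^ k - m * r ^ k) / (l - m))
          + (r - s) / (l - m) * ((r ^ k - s ^ k) / (l - m)) * (l + m)
          = (r ^ Suc k - s ^ Suc k) / (l - m)"
        using False by (simp add: divide_simps) (simp add: algebra_simps)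
      ultimately show ?thesis
        by (simp only: E_def lin_comb_mult lm power_one_right)
    qed
    have "matrix_prod (replicate k (E 1)) = E k" for k
    proof (induction k)
      case 0
      then show ?case using False by (simp add: E_def)
    next
      case (Suc k)
      then show ?case by (simp add: step[simplified])
    qed
    moreover have "E n = D"
      using False by (simp add: E_def r s field_simps)
    ultimately show thesis
      using that unfolding E_def by metis
  next
    case True
    have "l \<noteq> 0"
      using assms(1) True by (auto simp: invertible_det_nz lm)
    \<comment> \<open>the binomial series of \<open>(l + (D - l)) powr (k / n)\<close>, which stops since \<open>(D - l)\<^sup>2 = 0\<close>\<close>
    define E where "E k =
      lin_comb (r ^ k * (1 - of_nat k / of_nat n)) (r ^ k * of_nat k / (of_nat n * l)) D" for k
    have step: "E 1 ** E k = E (Suc k)" for k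
    proof -
      have "r * (1 - 1 / of_nat n) * (r ^ k * (1 - of_nat k / of_nat n))
          - r * 1 / (of_nat n * l) * (r ^ k * of_nat k / (of_nat n * l)) * (l * l)
          = r ^ Suc k * (1 - of_nat (Suc k) / of_nat n)"
        using \<open>l \<noteq> 0\<close> \<open>n > 0\<close> by (simp add: divide_simps) (simp add: algebra_simps)
      moreover have "r * (1 - 1 / of_nat n) * (r ^ k * of_nat k / (of_nat n * l))
          + r * 1 / (of_nat n * l) * (r ^ k * (1 - of_nat k / of_nat n))
          + r * 1 / (of_nat n * l) * (r ^ k * of_nat k / (of_nat n * l)) * (l + l)
          = r ^ Suc k * of_nat (Suc k) / (of_nat n * l)"
        using \<open>l \<noteq> 0\<close> \<open>n > 0\<close> by (simp add: divide_simps) (simp add: algebra_simps)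
      ultimately show ?thesis
        by (simp only: E_def lin_comb_mult lm True[symmetric] power_one_right of_nat_1)
    qed
    have "matrix_prod (replicate k (E 1)) = E k" for k
    proof (induction k)
      case 0
      then show ?case by (simp add: E_def)
    next
      case (Suc k)
      then show ?case by (simp add: step[simplified])
    qed
    moreover have "E n = D"
      using \<open>l \<noteq> 0\<close> \<open>n > 0\<close> by (simp add: E_def r)
    ultimately show thesis
      using that unfolding E_def by metis
  qed
qed

section \<open>Tensor products of operators\<close>

lemma tensor_op_mult: "tensor_op A ** tensor_op B = tensor_op (\<lambda>k. A k ** B k)"
proof -
  have "(\<Sum>h\<in>UNIV. (\<Prod>k\<in>UNIV. A k $ i k $ h k) * (\<Prod>k\<in>UNIV. B k $ h k $ j k))
      = (\<Prod>k\<in>UNIV. \<Sum>l\<in>UNIV. A k $ i k $ l * B k $ l $ j k)" for i j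
    using prod_sum_PiE[of UNIV "\<lambda>_. UNIV" "\<lambda>k l. A k $ i k $ l * B k $ l $ j k"]
    by (simp add: PiE_UNIV_domain prod.distrib)
  then show ?thesis
    by (simp add: tensor_op_def matrix_matrix_mult_def vec_eq_iff)
qed

lemma tensor_op_one: "tensor_op (\<lambda>_. mat 1) = mat 1"
proof -
  have "(\<Prod>k\<in>UNIV. if i k = j k then 1 else 0) = (if i = j then 1 else (0::complex))"
    for i j :: "'n::finite \<Rightarrow> 2"
    by (auto simp: fun_eq_iff intro!: prod_zero)
  then show ?thesis
    by (auto simp: tensor_op_def mat_def vec_eq_iff fun_eq_iff)
qed

lemma permute_factors_tensor_op:
  assumes "\<sigma> permutes UNIV"
  shows "permute_factors \<sigma> (tensor_op A *v \<psi>)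
    = tensor_op (A \<circ> inv \<sigma>) *v permute_factors \<sigma> \<psi>"
proof -
  have "bij (\<lambda>j :: 'a \<Rightarrow> 2. j \<circ> \<sigma>)"
    by (rule o_bij[of "\<lambda>j. j \<circ> inv \<sigma>"])
      (auto simp: fun_eq_iff permutes_inverses[OF assms])
  then have "(\<Sum>j\<in>UNIV. (\<Prod>k\<in>UNIV. A k $ i (\<sigma> k) $ j k) * \<psi> $ j)
      = (\<Sum>j\<in>UNIV. (\<Prod>k\<in>UNIV. A k $ i (\<sigma> k) $ j (\<sigma> k)) * \<psi> $ (j \<circ> \<sigma>))" for i
    using sum.reindex_bij_betw[of "\<lambda>j. j \<circ> \<sigma>" UNIV UNIV
        "\<lambda>j. (\<Prod>k\<in>UNIV. A k $ i (\<sigma> k) $ j k) * \<psi> $ j"] by simp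
  moreover have "(\<Prod>k\<in>UNIV. A k $ i (\<sigma> k) $ j (\<sigma> k)) = (\<Prod>k\<in>UNIV. A (inv \<sigma> k) $ i k $ j k)"
    for i j
    using prod.permute[OF assms, of "\<lambda>k. A (inv \<sigma> k) $ i k $ j k"] permutes_inverses(2)[OF assms]
    by (simp add: o_def)
  ultimately show ?thesis
    by (simp add: permute_factors_def tensor_op_def matrix_vector_mult_def vec_eq_iff)
qed

definition site_op :: "'n::finite \<Rightarrow> complex ^ 2 ^ 2 \<Rightarrow> complex ^ ('n \<Rightarrow> 2) ^ ('n \<Rightarrow> 2)" where
  "site_op k M = tensor_op ((\<lambda>_. mat 1)(k := M))"

lemma site_op_one [simp]: "site_op k (mat 1) = mat 1"
  by (simp add: site_op_def fun_upd_idem tensor_op_one)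

lemma site_op_mult: "site_op k M ** site_op k M' = site_op k (M ** M')"
  by (auto simp: site_op_def tensor_op_mult fun_upd_def intro!: arg_cong[of _ _ tensor_op])

text \<open>Together the two forms say that an operator on factor \<open>k\<close> commutes with a
  tensor product that is trivial there.\<close>

lemma tensor_op_fun_upd:
  assumes "A k = mat 1"
  shows "tensor_op (A(k := M)) = site_op k M ** tensor_op A"
    and "tensor_op (A(k := M)) = tensor_op A ** site_op k M"
  using assms
  by (auto simp: site_op_def tensor_op_mult intro!: arg_cong[of _ _ tensor_op])

text \<open>By \<open>entry\<close>, each matrix entry depends on \<open>M\<close> through one
  factor only, hence linearly.\<close>

lemma site_op_lin_comb:
  "site_op k (lin_comb a b D) *v \<psi> = a *s \<psi> + b *s (site_op k D *v \<psi>)"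
proof -
  have entry: "tensor_op ((\<lambda>_. mat 1)(k := M)) $ i $ j
      = M $ i k $ j k * (\<Prod>h\<in>UNIV - {k}. mat 1 $ i h $ j h)"
    for M :: "complex ^ 2 ^ 2" and i j
    by (simp add: tensor_op_def prod.remove[of UNIV k])
  have "site_op k (lin_comb a b D) $ i $ j = a * mat 1 $ i $ j + b * site_op k D $ i $ j" for i j
    unfolding site_op_one[of k, symmetric] site_op_def entry
    by (simp add: lin_comb_def mat_def algebra_simps)
  then have "(site_op k (lin_comb a b D) *v \<psi>) $ i
      = a * (mat 1 *v \<psi>) $ i + b * (site_op k D *v \<psi>) $ i" for i
    by (simp add: matrix_vector_mult_def sum_distrib_left sum.distrib algebra_simps)
  then show ?thesis
    by (simp add: vec_eq_iff)
qed

section \<open>Operators that slide along a vector\<close>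

definition slides :: "complex ^ 2 ^ 2 \<Rightarrow> 'n::finite qubits \<Rightarrow> bool" where
  "slides M \<psi> \<longleftrightarrow> (\<forall>k l. site_op k M *v \<psi> = site_op l M *v \<psi>)"

lemma slides_lin_comb: "slides D \<psi> \<Longrightarrow> slides (lin_comb a b D) \<psi>"
  by (simp add: slides_def site_op_lin_comb)

text \<open>The transposition relabels the factor acted on, and the symmetric \<open>\<psi>\<close>
  absorbs it.\<close>

lemma permute_factors_site_op:
  assumes "symmetric_state \<psi>"
  shows "permute_factors (Transposition.transpose k l) (site_op k M *v \<psi>) = site_op l M *v \<psi>"
    and "h \<notin> {k, l} \<Longrightarrow>
      permute_factors (Transposition.transpose k l) (site_op h M *v \<psi>) = site_op h M *v \<psi>"
proof -
  have \<tau>: "Transposition.transpose k l permutes UNIV"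
    by (simp add: permutes_swap_id)
  have "permute_factors (Transposition.transpose k l) \<psi> = \<psi>"
    using assms \<tau> by (simp add: symmetric_state_def)
  then have *: "permute_factors (Transposition.transpose k l) (site_op h M *v \<psi>)
      = tensor_op ((\<lambda>_. mat 1)(h := M) \<circ> Transposition.transpose k l) *v \<psi>" for h
    by (simp add: site_op_def permute_factors_tensor_op[OF \<tau>])
  have "(\<lambda>_. mat 1)(k := M) \<circ> Transposition.transpose k l = (\<lambda>_. mat 1)(l := M)"
    by (auto simp: fun_eq_iff Transposition.transpose_def)
  then show "permute_factors (Transposition.transpose k l) (site_op k M *v \<psi>) = site_op l M *v \<psi>"
    by (simp only: *) (simp only: site_op_def)
  assume "h \<notin> {k, l}"
  then have "(\<lambda>_. mat 1)(h := M) \<circ> Transposition.transpose k l = (\<lambda>_. mat 1)(h := M)"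
    by (auto simp: fun_eq_iff Transposition.transpose_def)
  then show "permute_factors (Transposition.transpose k l) (site_op h M *v \<psi>) = site_op h M *v \<psi>"
    by (simp only: *) (simp only: site_op_def)
qed

lemma slides_if_pair:
  assumes "symmetric_state \<psi>" and "k \<noteq> l" and "site_op k M *v \<psi> = site_op l M *v \<psi>"
  shows "slides M \<psi>"
proof -
  have "site_op q M *v \<psi> = site_op k M *v \<psi>" for q
  proof (cases "q = k")
    case False
    then show ?thesis
      \<comment> \<open>Exchanging \<open>l\<close> and \<open>q\<close> carries \<open>M\<close>
        from \<open>l\<close> to \<open>q\<close> but leaves its action on factor \<open>k\<close>
        alone.\<close>
      using permute_factors_site_op[OF assms(1)] assms(2,3)
      by (metis empty_iff insert_iff)
  qed simp
  then show ?thesis unfolding slides_def by metis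
qed

lemma slides_if_symmetric:
  assumes "symmetric_state \<psi>" and "symmetric_state (site_op p M *v \<psi>)"
  shows "slides M \<psi>"
proof -
  have "site_op q M *v \<psi> = site_op p M *v \<psi>" for q
    using permute_factors_site_op(1)[OF assms(1), of p q M] assms(2)
    by (simp add: symmetric_state_def permutes_swap_id)
  then show ?thesis unfolding slides_def by metis
qed

text \<open>Induction: \<open>C x\<close> acts first on \<open>\<psi>\<close>, so it can slide to
  \<open>p\<close>; it then commutes past the remaining operators, which are trivial at
  \<open>p\<close> because \<open>p\<close> is not in \<open>ks\<close>.\<close>

lemma tensor_op_slide:
  assumes "distinct ks" and "p \<notin> set ks" and "\<And>k. k \<in> set ks \<Longrightarrow> slides (C k) \<psi>"
  shows "tensor_op (\<lambda>k. if k \<in> set ks then C k else mat 1) *v \<psi>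
    = site_op p (matrix_prod (map C ks)) *v \<psi>"
  using assms
proof (induction ks)
  case Nil
  then show ?case by (simp add: tensor_op_one)
next
  case (Cons x ks)
  define T where "T = (\<lambda>k. if k \<in> set ks then C k else mat 1)"
  have T: "T x = mat 1" "T p = mat 1" using Cons.prems by (auto simp: T_def)
  have "(\<lambda>k. if k \<in> set (x # ks) then C k else mat 1) = T(x := C x)"
    by (auto simp: T_def)
  then have "tensor_op (\<lambda>k. if k \<in> set (x # ks) then C k else mat 1) *v \<psi>
      = tensor_op T *v (site_op x (C x) *v \<psi>)"
    by (simp add: tensor_op_fun_upd(2)[of T x, OF T(1)] matrix_vector_mul_assoc)
  also have "site_op x (C x) *v \<psi> = site_op p (C x) *v \<psi>"
    using Cons.prems(3) by (simp add: slides_def)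
  also have "tensor_op T *v (site_op p (C x) *v \<psi>) = site_op p (C x) *v (tensor_op T *v \<psi>)"
    using tensor_op_fun_upd[of T p, OF T(2)] by (metis matrix_vector_mul_assoc)
  also have "tensor_op T *v \<psi> = site_op p (matrix_prod (map C ks)) *v \<psi>"
    unfolding T_def using Cons by simp
  finally show ?case
    by (simp add: matrix_vector_mul_assoc site_op_mult)
qed

section \<open>Local operations between symmetric states\<close>

lemma matrix_inv_mult:
  assumes "invertible M"
  shows "M ** matrix_inv M = mat 1" and "matrix_inv M ** M = mat 1"
  using assms unfolding invertible_def matrix_inv_def
  by (metis (mono_tags, lifting) someI_ex)+

lemma symmetric_state_tensor_power:
  assumes "symmetric_state \<phi>" and "invertible B"
  shows "symmetric_state (tensor_power_op B *v \<phi>)"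
proof -
  have "tensor_power_op (matrix_inv B) *v (tensor_power_op B *v \<phi>) = \<phi>"
    by (simp add: matrix_vector_mul_assoc tensor_op_mult matrix_inv_mult[OF assms(2)] tensor_op_one)
  then have "tensor_power_op B *v \<phi> \<noteq> 0"
    using assms(1) by (metis matrix_vector_mult_0_right symmetric_state_def)
  then show ?thesis
    using assms(1) by (simp add: symmetric_state_def permute_factors_tensor_op o_def)
qed

lemma slides_inv_mult:
  assumes "symmetric_state \<psi>" and "symmetric_state (tensor_op A *v \<psi>)"
    and inv: "\<And>k. invertible (A k)"
  shows "slides (matrix_inv (A p) ** A k) \<psi>"
proof (cases "k = p")
  case True
  then show ?thesis by (simp add: slides_def matrix_inv_mult inv)
next
  case False
  define \<tau> where "\<tau> = Transposition.transpose p k"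
  have \<tau>: "\<tau> permutes UNIV" "inv \<tau> = \<tau>"
    by (simp_all add: \<tau>_def permutes_swap_id)
  have "tensor_op (A \<circ> \<tau>) *v \<psi> = tensor_op A *v \<psi>"
    using permute_factors_tensor_op[OF \<tau>(1), of A \<psi>] assms(1,2) \<tau>
    by (simp add: symmetric_state_def)
  \<comment> \<open>\<open>L\<close> cancels every factor of \<open>A\<close> except at
    \<open>k\<close>, and every factor of \<open>A \<circ> \<tau>\<close> except at
    \<open>p\<close>; both leave \<open>matrix_inv (A p) ** A k\<close> there.\<close>
  moreover define L where "L = (\<lambda>q. matrix_inv (A q))(k := matrix_inv (A p))"
  have "site_op p (matrix_inv (A p) ** A k) = tensor_op L ** tensor_op (A \<circ> \<tau>)"
    "site_op k (matrix_inv (A p) ** A k) = tensor_op L ** tensor_op A"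
    using False unfolding site_op_def tensor_op_mult
    by (auto simp: L_def \<tau>_def Transposition.transpose_def matrix_inv_mult inv
        intro!: arg_cong[of _ _ tensor_op])
  ultimately have "site_op p (matrix_inv (A p) ** A k) *v \<psi>
      = site_op k (matrix_inv (A p) ** A k) *v \<psi>"
    by (simp flip: matrix_vector_mul_assoc)
  then show ?thesis
    using slides_if_pair[OF assms(1)] False by metis
qed

theorem mainTheorem1:
  fixes \<psi> \<phi> :: "'n::finite qubits"
  assumes "symmetric_state \<psi>" and "symmetric_state \<phi>"
    and "\<exists>A :: 'n \<Rightarrow> complex ^ 2 ^ 2. (\<forall>k. invertible (A k)) \<and> \<phi> = tensor_op A *v \<psi>"
  shows "\<exists>A :: complex ^ 2 ^ 2. invertible A \<and> \<phi> = tensor_power_op A *v \<psi>"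
proof -
  obtain A :: "'n \<Rightarrow> complex ^ 2 ^ 2" where inv: "\<And>k. invertible (A k)"
    and \<phi>: "\<phi> = tensor_op A *v \<psi>"
    using assms(3) by blast
  \<comment> \<open>Any factor will do; one exists because types are nonempty, which is N \<ge>
    1.\<close>
  fix p :: 'n
  obtain ks where ks: "set ks = UNIV - {p}" "distinct ks"
    using finite_distinct_list[of "UNIV - {p}"] by auto
  define C where "C k = matrix_inv (A p) ** A k" for k
  define D where "D = matrix_prod (map C ks)"
  have inv_p: "invertible (matrix_inv (A p))"
    using matrix_inv_mult[OF inv] by (auto simp: invertible_def)
  have inv_D: "invertible D"
    unfolding D_def C_def using inv inv_p by (auto intro!: invertible_matrix_prod invertible_mult)
  have "C p = mat 1"
    by (simp add: C_def matrix_inv_mult inv)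
  then have "(\<lambda>k. if k \<in> set ks then C k else mat 1) = C"
    by (simp add: ks fun_eq_iff)
  moreover have "slides (C k) \<psi>" for k
    unfolding C_def using slides_inv_mult[of \<psi> A] assms(1,2) \<phi> inv by simp
  ultimately have C: "tensor_op C *v \<psi> = site_op p D *v \<psi>"
    using tensor_op_slide[of ks p C \<psi>] ks by (simp add: D_def)
  have "tensor_op C *v \<psi> = tensor_power_op (matrix_inv (A p)) *v \<phi>"
    by (simp add: \<phi> C_def[abs_def] matrix_vector_mul_assoc tensor_op_mult)
  then have "symmetric_state (site_op p D *v \<psi>)"
    using symmetric_state_tensor_power[OF assms(2) inv_p] C by simp
  then have "slides D \<psi>"
    using assms(1) slides_if_symmetric by blast
  \<comment> \<open>\<open>ks\<close> omits only \<open>p\<close>, so \<open>Suc (length ks)\<close>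
    is N.\<close>
  obtain a b where root: "matrix_prod (replicate (Suc (length ks)) (lin_comb a b D)) = D"
    using matrix_root_exists[OF inv_D] by blast
  define E where "E = lin_comb a b D"
  have E: "E ** matrix_prod (replicate (length ks) E) = D"
    using root by (simp add: E_def)
  \<comment> \<open>Factor \<open>p\<close> is held back so that the other copies of
    \<open>E\<close> can slide onto it.\<close>
  define T where "T = (\<lambda>k. if k \<in> set ks then E else mat 1)"
  have "T p = mat 1" "T(p := E) = (\<lambda>_. E)"
    by (simp_all add: T_def ks fun_eq_iff)
  then have "tensor_power_op E *v \<psi> = site_op p E *v (tensor_op T *v \<psi>)"
    using tensor_op_fun_upd(1)[of T p E] by (simp add: matrix_vector_mul_assoc)
  also have "tensor_op T *v \<psi> = site_op p (matrix_prod (replicate (length ks) E)) *v \<psi>"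
    using tensor_op_slide[of ks p "\<lambda>_. E" \<psi>] ks slides_lin_comb[OF \<open>slides D \<psi>\<close>]
    by (simp add: T_def E_def map_replicate_const)
  finally have "tensor_power_op E *v \<psi> = tensor_op C *v \<psi>"
    by (simp add: matrix_vector_mul_assoc site_op_mult E C)
  then have "tensor_power_op (A p ** E) *v \<psi> = tensor_op (\<lambda>k. A p ** C k) *v \<psi>"
    by (simp flip: tensor_op_mult matrix_vector_mul_assoc)
  also have "(\<lambda>k. A p ** C k) = A"
    by (simp add: C_def matrix_mul_assoc matrix_inv_mult inv)
  finally have "\<phi> = tensor_power_op (A p ** E) *v \<psi>"
    by (simp add: \<phi>)
  moreover have "invertible E"
    \<comment> \<open>\<open>E\<close> is a left factor of \<open>D\<close>, so \<open>det E\<close>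
      divides the nonzero \<open>det D\<close>.\<close>
    using inv_D by (simp add: invertible_det_nz det_mul flip: E)
  ultimately show ?thesis
    using inv invertible_mult by blast
qed

end
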